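(* Let $n\ge1$, let $L_{2n}$ be the last return time to zero of a simple symmetric random walk of length $2n$, and let $Z$ have the Arcsine distribution. Then $$d_W\left(\frac{L_{2n}}{2n},Z\right)\le\frac{27}{2n}+\frac{8}{n^2}.$$ The same bound holds with $L_{2n}$ replaced by $U_{2n}$ or by $R_{2n}$. The $O(1/n)$ rate of the bound cannot be improved, that is, there is a constant $c>0$ such that $d_W(L_{2n}/(2n),Z)\ge c/n$ for all $n\ge1$.
   Context: The simple symmetric random walk is $T_0=0$, $T_k=X_1+\cdots+X_k$, where $X_1,X_2,\ldots$ are independent and take the values $1$ and $-1$ with probability $1/2$ each. Define: - $L_{2n}=\sup\{k\le 2n: T_k=0\}$, the last return time to zero up to time $2n$; - $U_{2n}$, the number of the $2n$ segments of the walk (the $k$-th segment joins $(k-1,T_{k-1})$ to $(k,T_k)$, $1\le k\le 2n$) that lie above the $x$ axis, i.e. the number of $k$ with $T_{k-1}\ge0$ and $T_k\ge 0$; - $R_{2n}=\inf\{k\ge0: T_k=T_{2n}\}$, the first time the walk visits its terminal point $T_{2n}$. The Arcsine distribution is the Beta distribution $\mathcal B(1/2,1/2)$, with density $\frac{1}{\pi\sqrt{x(1-x)}}$ on $(0,1)$. Wasserstein distance: $d_W(X,Y)=\sup_{h\in\mathrm{Lip}(1)}|\mathbb E[h(X)]-\mathbb E[h(Y)]|$, where $\mathrm{Lip}(1)=\{h:|h(x)-h(y)|\le|x-y|\}$. *)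

theory Defs
  imports "HOL-Probability.Probability"
begin

text \<open>The steps are indexed from 1; the value of \<open>X 0\<close> is irrelevant. The values \<open>1\<close> and
  \<open>-1\<close> are taken almost surely, since the two probabilities add up to one.\<close>

locale simple_random_walk = prob_space M
  for M :: "'a measure" +
  fixes X :: "nat \<Rightarrow> 'a \<Rightarrow> int"
  assumes indep_steps: "indep_vars (\<lambda>_. count_space UNIV) X {1..}"
    and prob_up: "\<And>k. k \<ge> 1 \<Longrightarrow> prob {\<omega> \<in> space M. X k \<omega> = 1} = 1 / 2"
    and prob_down: "\<And>k. k \<ge> 1 \<Longrightarrow> prob {\<omega> \<in> space M. X k \<omega> = -1} = 1 / 2"

definition walk :: "(nat \<Rightarrow> 'a \<Rightarrow> int) \<Rightarrow> nat \<Rightarrow> 'a \<Rightarrow> int" where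
  "walk X k \<omega> = (\<Sum>i=1..k. X i \<omega>)"

text \<open>In the next three definitions \<open>m\<close> is the length of the walk. The set in \<open>last_zero\<close> is
  finite and contains \<open>0\<close>, the one in \<open>first_visit_end\<close> contains \<open>m\<close>, so \<open>Sup\<close> and \<open>Inf\<close> on
  \<^typ>\<open>nat\<close> are an attained maximum and minimum.\<close>

definition last_zero :: "(nat \<Rightarrow> 'a \<Rightarrow> int) \<Rightarrow> nat \<Rightarrow> 'a \<Rightarrow> nat" where
  "last_zero X m \<omega> = Sup {k. k \<le> m \<and> walk X k \<omega> = 0}"

definition segments_above :: "(nat \<Rightarrow> 'a \<Rightarrow> int) \<Rightarrow> nat \<Rightarrow> 'a \<Rightarrow> nat" where
  "segments_above X m \<omega> = card {k \<in> {1..m}. walk X (k - 1) \<omega> \<ge> 0 \<and> walk X k \<omega> \<ge> 0}"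

definition first_visit_end :: "(nat \<Rightarrow> 'a \<Rightarrow> int) \<Rightarrow> nat \<Rightarrow> 'a \<Rightarrow> nat" where
  "first_visit_end X m \<omega> = Inf {k. walk X k \<omega> = walk X m \<omega>}"

definition arcsine_density :: "real \<Rightarrow> real" where
  "arcsine_density x = (if 0 < x \<and> x < 1 then 1 / (pi * sqrt (x * (1 - x))) else 0)"

definition arcsine_distributed :: "'b measure \<Rightarrow> ('b \<Rightarrow> real) \<Rightarrow> bool" where
  "arcsine_distributed N Z \<longleftrightarrow> prob_space N \<and> distributed N lborel Z arcsine_density"

text \<open>The supremum is taken in \<^typ>\<open>ereal\<close>, where it always exists. Both variables are meant to be
  integrable, so that the expectations of their images under Lipschitz functions exist. They
  may live on different probability spaces.\<close>

definition wasserstein_dist ::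
    "'a measure \<Rightarrow> ('a \<Rightarrow> real) \<Rightarrow> 'b measure \<Rightarrow> ('b \<Rightarrow> real) \<Rightarrow> ereal" where
  "wasserstein_dist M X N Y =
     (SUP h \<in> {h :: real \<Rightarrow> real. 1-lipschitz_on UNIV h}.
        ereal \<bar>(\<integral>\<omega>. h (X \<omega>) \<partial>M) - (\<integral>\<omega>. h (Y \<omega>) \<partial>N)\<bar>)"

end

theory Submission
  imports Defs
begin

text \<open>
  Everything rests on one discrete law. Let \<open>u k\<close> be the probability that a walk of length \<open>2 * k\<close>
  ends at zero. Each of the three statistics takes the value \<open>2 * k\<close> with probability
  \<open>u k * u (n - k)\<close>, the discrete arcsine law. For the last zero this is the Markov property at
  the last zero together with the convolution identity \<open>(\<Sum>k\<le>n. u k * u (n - k)) = 1\<close>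
  (\<open>sum_return_prob\<close>). For the number of segments above the axis it follows from a first-step
  recursion in which the starting height is allowed to vary (\<open>num_paths_above\<close>). Reversing time
  turns the first visit to the terminal point into \<open>2 * n\<close> minus a last zero.

  The Wasserstein bound comes from the monotone coupling of a variable \<open>K\<close> with the discrete
  arcsine law on \<open>{0..n}\<close> with the arcsine variable \<open>Z\<close>. It suffices that the distribution function
  of \<open>K\<close> at \<open>k\<close> lies between the arcsine distribution function at \<open>(k - 1) / n\<close> and at
  \<open>(k + 2) / n\<close>: then \<open>K / n\<close> and the coupled \<open>Z\<close> differ by at most \<open>2 / n\<close>. By the reflection
  \<open>k \<mapsto> n - k\<close> only the lower comparison is needed. It holds at the middle by symmetry, and it
  spreads to both sides because the Wallis bounds \<open>1 / (\<pi> * (k + 1/2)) \<le> (u k)\<^sup>2 \<le> 1 / (\<pi> * k)\<close>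
  compare each weight \<open>u k * u (n - k)\<close> with the increment of an arcsine distribution function:
  below the middle on the scale of \<open>{0..n}\<close>, above it on the scale of the slightly
  longer interval from \<open>-1/2\<close> to \<open>n + 1/2\<close>. This gives a distance of at most \<open>2 / n\<close>.

  The rate is optimal because \<open>K / n\<close> lives on the lattice of multiples of \<open>1 / n\<close>. The \<open>1\<close>-Lipschitz
  function \<open>sin (\<pi> * n * x)^2 / (\<pi> * n)\<close> vanishes on this lattice, while its mean under the arcsine
  law is at least \<open>1 / (\<pi>\<^sup>2 * n)\<close>, as the arcsine density is at least \<open>2 / \<pi>\<close>.
\<close>

section \<open>Counting sign sequences\<close>

definition sign_lists :: "nat \<Rightarrow> int list set" where
  "sign_lists m = {xs. set xs \<subseteq> {1, -1} \<and> length xs = m}"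

definition num_paths :: "nat \<Rightarrow> (int list \<Rightarrow> bool) \<Rightarrow> nat" where
  "num_paths m P = card {xs \<in> sign_lists m. P xs}"

lemma finite_sign_lists [simp]: "finite (sign_lists m)"
  unfolding sign_lists_def by (rule finite_lists_length_eq) simp

lemma card_sign_lists: "card (sign_lists m) = 2 ^ m"
  unfolding sign_lists_def by (subst card_lists_length_eq) (simp_all add: numeral_2_eq_2)

lemma num_paths_0: "num_paths 0 P = (if P [] then 1 else 0)"
proof -
  have "{xs \<in> sign_lists 0. P xs} = (if P [] then {[]} else {})"
    by (auto simp: sign_lists_def)
  then show ?thesis by (simp add: num_paths_def)
qed

lemma num_paths_Suc:
  "num_paths (Suc m) P = num_paths m (\<lambda>xs. P (1 # xs)) + num_paths m (\<lambda>xs. P (-1 # xs))"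
proof -
  have eq: "{xs \<in> sign_lists (Suc m). P xs} =
      Cons 1 ` {xs \<in> sign_lists m. P (1 # xs)} \<union> Cons (-1) ` {xs \<in> sign_lists m. P (-1 # xs)}"
    by (auto simp: sign_lists_def length_Suc_conv image_iff)
  show ?thesis
    unfolding num_paths_def eq
    by (subst card_Un_disjoint) (auto simp: card_image)
qed

lemma num_paths_cong:
  "(\<And>xs. xs \<in> sign_lists m \<Longrightarrow> P xs \<longleftrightarrow> Q xs) \<Longrightarrow> num_paths m P = num_paths m Q"
  unfolding num_paths_def by (rule arg_cong[where f = card]) auto

lemma num_paths_bij:
  assumes "\<And>xs. xs \<in> sign_lists m \<Longrightarrow> f xs \<in> sign_lists m" and "\<And>xs. f (f xs) = xs"
  shows "num_paths m (\<lambda>xs. P (f xs)) = num_paths m P"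
  unfolding num_paths_def
  by (rule bij_betw_same_card[where f = f], rule bij_betwI[where g = f]) (auto simp: assms)

lemma num_paths_uminus: "num_paths m (\<lambda>xs. P (map uminus xs)) = num_paths m P"
  by (rule num_paths_bij) (auto simp: sign_lists_def o_def)

lemma num_paths_rev: "num_paths m (\<lambda>xs. P (rev xs)) = num_paths m P"
  by (rule num_paths_bij) (auto simp: sign_lists_def)

text \<open>Double counting: a relation that assigns to every sign list exactly one label splits the
  \<open>2 ^ m\<close> lists into the classes of the labels. The counts that a first-step recursion does not reach
  are obtained from such a total.\<close>
lemma sum_num_paths:
  assumes "finite B" and "\<And>xs. xs \<in> sign_lists m \<Longrightarrow> \<exists>!j. j \<in> B \<and> R xs j"
  shows "(\<Sum>j\<in>B. num_paths m (\<lambda>xs. R xs j)) = 2 ^ m"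
proof -
  have "card {j \<in> B. R xs j} = 1" if "xs \<in> sign_lists m" for xs
  proof -
    from assms(2)[OF that] obtain j where "{j \<in> B. R xs j} = {j}" by blast
    then show ?thesis by simp
  qed
  then have "(\<Sum>j\<in>B. card {xs \<in> sign_lists m. R xs j}) = 1 * card (sign_lists m)"
    by (intro sum_multicount assms(1)) auto
  then show ?thesis by (simp add: num_paths_def card_sign_lists)
qed

text \<open>Starting at height \<open>a\<close> rather than at \<open>0\<close> makes the first-step recursion close up.\<close>
definition paths_to_zero :: "nat \<Rightarrow> int \<Rightarrow> nat" where
  "paths_to_zero j a = num_paths j (\<lambda>xs. a + sum_list xs = 0)"

lemma paths_to_zero_0: "paths_to_zero 0 a = (if a = 0 then 1 else 0)"
  by (simp add: paths_to_zero_def num_paths_0)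

lemma paths_to_zero_Suc: "paths_to_zero (Suc j) a = paths_to_zero j (a + 1) + paths_to_zero j (a - 1)"
  by (simp add: paths_to_zero_def num_paths_Suc algebra_simps)

lemma paths_to_zero_uminus: "paths_to_zero j (- a) = paths_to_zero j a"
  by (induction j arbitrary: a) (simp_all add: paths_to_zero_0 paths_to_zero_Suc, metis add.commute minus_diff_eq
      minus_add_distrib uminus_add_conv_diff diff_minus_eq_add)

lemma paths_to_zero_step_from_0: "paths_to_zero (Suc j) 0 = 2 * paths_to_zero j 1"
  using paths_to_zero_uminus[of j 1] by (simp add: paths_to_zero_Suc)

lemma paths_to_zero_odd: "odd (int j + a) \<Longrightarrow> paths_to_zero j a = 0"
  by (induction j arbitrary: a) (auto simp: paths_to_zero_0 paths_to_zero_Suc)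

lemma paths_to_zero_far: "a < - int j \<Longrightarrow> paths_to_zero j a = 0"
  by (induction j arbitrary: a) (auto simp: paths_to_zero_0 paths_to_zero_Suc)

text \<open>A path of \<open>j\<close> steps with \<open>i\<close> of them downwards changes its height by \<open>j - 2 * i\<close>, so it ends at
  zero exactly when it starts at \<open>2 * i - j\<close>.\<close>
lemma paths_to_zero_binomial: "paths_to_zero j (2 * int i - int j) = j choose i"
proof (induction j arbitrary: i)
  case 0
  then show ?case by (cases i) (simp_all add: paths_to_zero_0)
next
  case (Suc j)
  show ?case
  proof (cases i)
    case 0
    then show ?thesis using Suc.IH[of 0] paths_to_zero_far[of "- 2 - int j" j]
      by (simp add: paths_to_zero_Suc)
  next
    case (Suc i')
    then show ?thesis using Suc.IH[of "Suc i'"] Suc.IH[of i']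
      by (simp add: paths_to_zero_Suc algebra_simps)
  qed
qed

lemma paths_to_zero_even: "paths_to_zero (2 * k) 0 = (2 * k) choose k"
  using paths_to_zero_binomial[of "2 * k" k] by simp

lemma sum_even_support:
  fixes g :: "nat \<Rightarrow> 'c :: comm_monoid_add"
  assumes "\<And>j. odd j \<Longrightarrow> g j = 0"
  shows "(\<Sum>j\<le>2 * n. g j) = (\<Sum>k\<le>n. g (2 * k))"
  by (induction n) (simp_all add: assms)

definition return_prob :: "nat \<Rightarrow> real" where
  "return_prob k = real ((2 * k) choose k) / 4 ^ k"

lemma return_prob_0 [simp]: "return_prob 0 = 1" by (simp add: return_prob_def)

lemma return_prob_pos: "return_prob k > 0"
  by (simp add: return_prob_def)

lemma return_prob_Suc: "return_prob (Suc k) = return_prob k * (2 * real k + 1) / (2 * real k + 2)"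
proof -
  have aux: "2 * (d * y) / K / (4 * c) = y / c * d / (2 * K)" if "K \<noteq> 0" "c \<noteq> 0" for y d c K :: real
    using that by (simp add: field_simps)
  have "Suc k * (Suc (2 * k) choose k) = Suc (2 * k) * ((2 * k) choose k)"
    using Suc_times_binomial_eq[of "2 * k" k] binomial_symmetric[of k "Suc (2 * k)"]
    by (simp add: Suc_diff_le mult.commute del: binomial_Suc_Suc)
  moreover have "(Suc (Suc (2 * k)) choose Suc k) = 2 * (Suc (2 * k) choose k)"
    using binomial_symmetric[of k "Suc (2 * k)"] by (simp add: Suc_diff_le)
  ultimately have "Suc k * (2 * Suc k choose Suc k) = 2 * (Suc (2 * k) * ((2 * k) choose k))"
    by (simp del: binomial_Suc_Suc)
  then have "real (Suc k) * real (2 * Suc k choose Suc k)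
      = 2 * (real (Suc (2 * k)) * real ((2 * k) choose k))"
    by (metis of_nat_mult of_nat_numeral)
  then have "real (2 * Suc k choose Suc k)
      = 2 * (real (Suc (2 * k)) * real ((2 * k) choose k)) / real (Suc k)"
    by (simp add: field_simps del: binomial_Suc_Suc mult_Suc_right of_nat_Suc)
  then have "return_prob (Suc k) = return_prob k * real (Suc (2 * k)) / (2 * real (Suc k))"
    unfolding return_prob_def power_Suc using aux by (simp only: of_nat_eq_0_iff) simp
  then show ?thesis by (simp add: algebra_simps)
qed

text \<open>The generating function of the return probabilities is \<open>(1 - x)\<close> to the power \<open>-1/2\<close>.\<close>
lemma return_prob_gbinomial: "(-1/2 :: real) gchoose k = (-1) ^ k * return_prob k"
proof (induction k)
  case 0
  then show ?case by simp
next
  case (Suc k)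
  have "(-1/2 :: real) gchoose Suc k = ((-1/2) gchoose k) * (-1/2 - real k) / (real k + 1)"
    using gbinomial_mult_1[of "-1/2 :: real" k] by (simp add: field_simps)
  then show ?case
    unfolding Suc return_prob_Suc by (simp add: field_simps)
qed

text \<open>The square of that generating function is \<open>1 / (1 - x)\<close>, all of whose coefficients are \<open>1\<close>; in terms
  of coefficients this is Vandermonde's identity for the exponents \<open>-1/2\<close> and \<open>-1/2\<close>.\<close>
lemma sum_return_prob: "(\<Sum>k\<le>n. return_prob k * return_prob (n - k)) = 1"
proof -
  have "(\<Sum>k\<le>n. ((-1/2 :: real) gchoose k) * ((-1/2) gchoose (n - k))) = (-1) gchoose n"
    using gbinomial_Vandermonde[of "-1/2 :: real" "-1/2" n] by (simp add: atMost_atLeast0)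
  also have "\<dots> = (-1) ^ n"
    using gbinomial_minus[of "1 :: real" n] by (simp flip: binomial_gbinomial)
  also have "(\<Sum>k\<le>n. ((-1/2 :: real) gchoose k) * ((-1/2) gchoose (n - k)))
      = (\<Sum>k\<le>n. (-1) ^ n * (return_prob k * return_prob (n - k)))"
  proof (rule sum.cong)
    fix k assume "k \<in> {..n}"
    then have "(-1 :: real) ^ n = (-1) ^ k * (-1) ^ (n - k)" by (simp flip: power_add)
    then show "((-1/2 :: real) gchoose k) * ((-1/2) gchoose (n - k)) = (-1) ^ n * (return_prob k * return_prob (n - k))"
      unfolding return_prob_gbinomial by simp
  qed simp
  finally show ?thesis by (simp flip: sum_distrib_left)
qed

definition arcsine_pmf :: "nat \<Rightarrow> nat \<Rightarrow> real" where
  "arcsine_pmf n k = return_prob k * return_prob (n - k)"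

lemma paths_to_zero_prod:
  "k \<le> n \<Longrightarrow> real (paths_to_zero (2 * k) 0 * paths_to_zero (2 * n - 2 * k) 0) = 4 ^ n * (return_prob k * return_prob (n - k))"
proof -
  assume "k \<le> n"
  then have "(4::real) ^ n = 4 ^ k * 4 ^ (n - k)" by (simp flip: power_add)
  then show ?thesis using paths_to_zero_even[of k] paths_to_zero_even[of "n - k"]
    by (simp add: return_prob_def right_diff_distrib')
qed

lemma sum_paths_to_zero:
  assumes "even M"
  shows "(\<Sum>j\<le>M. paths_to_zero j 0 * paths_to_zero (M - j) 0) = 2 ^ M"
proof -
  from assms obtain n where M: "M = 2 * n" by (elim evenE)
  have "real (\<Sum>j\<le>M. paths_to_zero j 0 * paths_to_zero (M - j) 0)
      = (\<Sum>k\<le>n. real (paths_to_zero (2 * k) 0 * paths_to_zero (2 * n - 2 * k) 0))"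
    unfolding M by (subst sum_even_support) (simp_all add: paths_to_zero_odd)
  also have "\<dots> = 4 ^ n * (\<Sum>k\<le>n. return_prob k * return_prob (n - k))"
    unfolding sum_distrib_left by (rule sum.cong) (simp_all only: paths_to_zero_prod atMost_iff)
  also have "\<dots> = real (2 ^ M)"
    by (simp add: sum_return_prob M power_mult)
  finally show ?thesis
    by linarith
qed

text \<open>For even \<open>m\<close> the product vanishes at odd \<open>j\<close>, so the condition also says that
  \<open>f\<close> takes even values only.\<close>
definition discrete_arcsine :: "nat \<Rightarrow> (int list \<Rightarrow> nat) \<Rightarrow> bool" where
  "discrete_arcsine m f \<longleftrightarrow>
     (\<forall>xs\<in>sign_lists m. f xs \<le> m) \<and>
     (\<forall>j\<le>m. num_paths m (\<lambda>xs. f xs = j) = paths_to_zero j 0 * paths_to_zero (m - j) 0)"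

section \<open>The last zero\<close>

definition is_last_zero :: "int \<Rightarrow> int list \<Rightarrow> nat \<Rightarrow> bool" where
  "is_last_zero a xs j \<longleftrightarrow> j \<le> length xs \<and> a + sum_list (take j xs) = 0 \<and>
     (\<forall>i. j < i \<and> i \<le> length xs \<longrightarrow> a + sum_list (take i xs) \<noteq> 0)"

lemma is_last_zero_Cons: "is_last_zero a (x # xs) (Suc j) \<longleftrightarrow> is_last_zero (a + x) xs j"
  unfolding is_last_zero_def by (auto simp: add.assoc Suc_less_eq2)

text \<open>Cut the path at its last zero: the first part is any path to zero, the second part any path
  that never returns. The induction only peels off steps of the first part.\<close>
lemma num_paths_last_zero_from:
  "j \<le> m \<Longrightarrow> num_paths m (\<lambda>xs. is_last_zero a xs j)
     = paths_to_zero j a * num_paths (m - j) (\<lambda>xs. is_last_zero 0 xs 0)"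
proof (induction j arbitrary: m a)
  case 0
  have "num_paths m (\<lambda>xs. is_last_zero a xs 0) = 0" if "a \<noteq> 0"
    using that by (simp add: num_paths_def is_last_zero_def)
  then show ?case by (cases "a = 0") (simp_all add: paths_to_zero_0)
next
  case (Suc j)
  then obtain m' where m: "m = Suc m'" "j \<le> m'" by (cases m) auto
  show ?case unfolding m num_paths_Suc is_last_zero_Cons
    using Suc.IH[OF m(2)] by (simp add: paths_to_zero_Suc algebra_simps)
qed

lemma is_last_zero_unique:
  "is_last_zero a xs i \<Longrightarrow> is_last_zero a xs j \<Longrightarrow> i = j"
  unfolding is_last_zero_def by (metis nat_neq_iff)

lemma is_last_zero_Max: "is_last_zero 0 xs (Max {k. k \<le> length xs \<and> sum_list (take k xs) = 0})"
proof -
  define S where "S = {k. k \<le> length xs \<and> sum_list (take k xs) = 0}"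
  have iff: "k \<in> S \<longleftrightarrow> k \<le> length xs \<and> sum_list (take k xs) = 0" for k by (simp add: S_def)
  have fin: "finite S" by (simp add: S_def)
  have "0 \<in> S" by (simp add: iff)
  then have "Max S \<in> S" by (intro Max_in fin) blast
  moreover have "k \<le> Max S" if "k \<in> S" for k using Max_ge[OF fin that] .
  ultimately show ?thesis
    unfolding is_last_zero_def S_def[symmetric] iff by (auto dest: leD)
qed

lemma sum_num_paths_last_zero:
  "(\<Sum>j\<le>m. num_paths m (\<lambda>xs. is_last_zero 0 xs j)) = 2 ^ m"
proof (rule sum_num_paths)
  fix xs assume "xs \<in> sign_lists m"
  then have "length xs = m" by (simp add: sign_lists_def)
  then show "\<exists>!j. j \<in> {..m} \<and> is_last_zero 0 xs j"
    using is_last_zero_Max[of xs] is_last_zero_unique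
    by (metis atMost_iff is_last_zero_def)
qed simp

text \<open>The numbers of paths without return satisfy \<open>(\<Sum>j\<le>m. paths_to_zero j 0 * v (m - j)) = 2 ^ m\<close>, because every
  path has a last zero. For even \<open>m\<close> the numbers \<open>v i = paths_to_zero i 0\<close> satisfy it as well, and it
  determines \<open>v\<close> at even arguments recursively since the coefficient for \<open>j = 0\<close> is \<open>1\<close>.\<close>
lemma num_paths_no_return:
  "num_paths (2 * i) (\<lambda>xs. is_last_zero 0 xs 0) = paths_to_zero (2 * i) 0"
proof (induction i rule: less_induct)
  case (less i)
  let ?v = "\<lambda>m. num_paths m (\<lambda>xs. is_last_zero 0 xs 0)"
  have *: "(\<Sum>j\<le>2 * i. paths_to_zero j 0 * ?v (2 * i - j)) = (\<Sum>j\<le>2 * i. paths_to_zero j 0 * paths_to_zero (2 * i - j) 0)"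
  proof -
    have "(\<Sum>j\<le>2 * i. paths_to_zero j 0 * ?v (2 * i - j)) = (\<Sum>j\<le>2 * i. num_paths (2 * i) (\<lambda>xs. is_last_zero 0 xs j))"
      by (rule sum.cong[OF refl], rule num_paths_last_zero_from[symmetric]) simp
    then show ?thesis
      using sum_num_paths_last_zero[of "2 * i"] sum_paths_to_zero[of "2 * i"] by simp
  qed
  have "paths_to_zero j 0 * ?v (2 * i - j) = paths_to_zero j 0 * paths_to_zero (2 * i - j) 0" if "j \<in> {..2 * i} - {0}" for j
  proof (cases "even j")
    case True
    then obtain l where "j = 2 * l" by (elim evenE)
    with that less[of "i - l"] show ?thesis by (simp add: right_diff_distrib')
  qed (simp add: paths_to_zero_odd)
  then have "(\<Sum>j\<in>{..2 * i} - {0}. paths_to_zero j 0 * ?v (2 * i - j))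
      = (\<Sum>j\<in>{..2 * i} - {0}. paths_to_zero j 0 * paths_to_zero (2 * i - j) 0)"
    by (rule sum.cong[OF refl])
  with * show ?case
    unfolding sum.remove[OF finite_atMost, of 0 "2 * i", simplified] by (simp add: paths_to_zero_0)
qed

lemma num_paths_last_zero:
  assumes "even m" "j \<le> m"
  shows "num_paths m (\<lambda>xs. is_last_zero 0 xs j) = paths_to_zero j 0 * paths_to_zero (m - j) 0"
proof (cases "even j")
  case True
  with assms have "2 * ((m - j) div 2) = m - j" by simp
  then show ?thesis
    using num_paths_last_zero_from[OF assms(2), of 0] num_paths_no_return[of "(m - j) div 2"] by simp
qed (use num_paths_last_zero_from[OF assms(2), of 0] in \<open>simp add: paths_to_zero_odd\<close>)

section \<open>The number of segments above the axis\<close>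

fun above :: "int \<Rightarrow> int list \<Rightarrow> nat" where
  "above a [] = 0"
| "above a (x # xs) = (if a \<ge> 0 \<and> a + x \<ge> 0 then 1 else 0) + above (a + x) xs"

lemma above_le: "above a xs \<le> length xs"
  by (induction xs arbitrary: a) (auto intro: le_SucI)

text \<open>As steps are \<open>1\<close> or \<open>-1\<close>, every segment lies on exactly one side of the axis, and reflecting the walk
  exchanges the sides.\<close>
lemma above_uminus:
  "set xs \<subseteq> {1, -1} \<Longrightarrow> above (- a) (map uminus xs) + above a xs = length xs"
proof (induction xs arbitrary: a)
  case (Cons x xs)
  then have "above (- (a + x)) (map uminus xs) + above (a + x) xs = length xs" and "x = 1 \<or> x = -1"
    by (simp_all only: list.set insert_subset) auto
  then show ?case
    by (auto simp: algebra_simps)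
qed simp

lemma above_eq_card:
  "above a xs = card {k \<in> {1..length xs}.
     a + sum_list (take (k - 1) xs) \<ge> 0 \<and> a + sum_list (take k xs) \<ge> 0}"
proof (induction xs arbitrary: a)
  case (Cons x xs)
  let ?A = "\<lambda>a xs. {k \<in> {1..length xs}. a + sum_list (take (k - 1) xs) \<ge> 0 \<and> a + sum_list (take k xs) \<ge> 0}"
  have "?A a (x # xs) = (if a \<ge> 0 \<and> a + x \<ge> 0 then {1} else {}) \<union> Suc ` ?A (a + x) xs"
  proof (rule set_eqI)
    fix k
    show "k \<in> ?A a (x # xs) \<longleftrightarrow> k \<in> (if a \<ge> 0 \<and> a + x \<ge> 0 then {1} else {}) \<union> Suc ` ?A (a + x) xs"
    proof (cases k)
      case (Suc l)
      then show ?thesis by (cases l) (auto simp: image_iff add.assoc)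
    qed auto
  qed
  moreover have "card (Suc ` ?A (a + x) xs) = above (a + x) xs"
    by (simp add: card_image Cons.IH)
  moreover have "1 \<notin> Suc ` ?A (a + x) xs" by auto
  ultimately show ?case by simp
qed simp

lemma num_paths_above_uminus:
  assumes "j \<le> m"
  shows "num_paths m (\<lambda>xs. above (- a) xs = j) = num_paths m (\<lambda>xs. above a xs = m - j)"
proof -
  have "num_paths m (\<lambda>xs. above (- a) xs = j) = num_paths m (\<lambda>xs. above (- a) (map uminus xs) = j)"
    by (rule num_paths_uminus[symmetric])
  also have "\<dots> = num_paths m (\<lambda>xs. above a xs = m - j)"
  proof (rule num_paths_cong)
    fix xs assume "xs \<in> sign_lists m"
    then show "above (- a) (map uminus xs) = j \<longleftrightarrow> above a xs = m - j"
      using above_uminus[of xs a] assms by (auto simp: sign_lists_def)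
  qed
  finally show ?thesis .
qed

text \<open>For \<open>a > 0\<close> the formula is the discrete counterpart of the density
  \<open>exp (- a^2 / (2 * s)) / (\<pi> * sqrt (s * (t - s)))\<close> of the time that Brownian motion started at \<open>a\<close> spends above
  zero up to time \<open>t\<close>. The case \<open>j = m\<close> has to be excluded for \<open>a > 0\<close>, as then the walk may stay above
  zero throughout. Starting from \<open>a > 0\<close>, the first segment is above and the claim follows from the one for
  \<open>a + 1\<close> and \<open>a - 1\<close>. Starting from \<open>0\<close>, the two possible first steps lead to mirror images of the case
  \<open>a = 1\<close>, each contributing half of the product, which settles \<open>0 < j < m\<close>. The two extreme values of
  \<open>j\<close> have equal counts by reflection, and their sum is what is missing in the total \<open>2 ^ m\<close>.\<close>
lemma num_paths_above:
  assumes "a \<ge> 0" "even (int m + a)" "j < m \<or> (a = 0 \<and> j \<le> m)"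
  shows "num_paths m (\<lambda>xs. above a xs = j) = paths_to_zero j a * paths_to_zero (m - j) 0"
  using assms
proof (induction m arbitrary: a j)
  case 0
  then show ?case by (simp add: num_paths_0 paths_to_zero_0)
next
  case (Suc m)
  let ?W = "\<lambda>m a j. num_paths m (\<lambda>xs. above a xs = j)"
  show ?case
  proof (cases "a = 0")
    case False
    with Suc.prems have a: "a \<ge> 1" and j: "j \<le> m" by auto
    have par: "even (int m + (a + 1))" "even (int m + (a - 1))" using Suc.prems by auto
    show ?thesis
    proof (cases j)
      case 0
      with a show ?thesis by (simp add: num_paths_Suc paths_to_zero_0) (simp add: num_paths_def)
    next
      case (Suc i)
      have "?W (Suc m) a j = ?W m (a + 1) i + ?W m (a - 1) i"
        using a Suc by (simp add: num_paths_Suc)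
      also have "\<dots> = paths_to_zero j a * paths_to_zero (m - i) 0"
        using Suc.IH[OF _ par(1), of i] Suc.IH[OF _ par(2), of i] a j Suc
        by (simp add: paths_to_zero_Suc algebra_simps)
      finally show ?thesis using Suc by simp
    qed
  next
    case True
    then have ev: "even (Suc m)" using Suc.prems by simp
    have inner: "?W (Suc m) 0 j = paths_to_zero j 0 * paths_to_zero (Suc m - j) 0" if j: "0 < j" "j < Suc m" for j
    proof -
      from j obtain i where i: "j = Suc i" by (cases j) auto
      with j obtain l where l: "m - i = Suc l" "l = m - j" by (cases "m - i") auto
      have "?W (Suc m) 0 j = ?W m 1 i + ?W m (-1) j"
        using i by (simp add: num_paths_Suc)
      also have "?W m (-1) j = ?W m 1 l"
        using num_paths_above_uminus[of j m 1] j l by simp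
      also have "?W m 1 i = paths_to_zero i 1 * paths_to_zero (m - i) 0"
        using Suc.IH[of 1 i] ev i j by simp
      also have "?W m 1 l = paths_to_zero l 1 * paths_to_zero (m - l) 0"
        using Suc.IH[of 1 l] ev l j by simp
      also have "m - l = j" using l i j by simp
      finally show ?thesis
        using i l by (simp add: paths_to_zero_step_from_0)
    qed
    \<comment> \<open>The extreme counts are equal, and the total leaves only one value for them.\<close>
    have ends: "?W (Suc m) 0 0 = ?W (Suc m) 0 (Suc m)"
      using num_paths_above_uminus[of 0 "Suc m" 0] by simp
    have "(\<Sum>j\<le>Suc m. ?W (Suc m) 0 j) = 2 ^ Suc m"
      by (rule sum_num_paths) (auto simp: sign_lists_def, metis above_le)
    then have "(\<Sum>j\<le>Suc m. ?W (Suc m) 0 j) = (\<Sum>j\<le>Suc m. paths_to_zero j 0 * paths_to_zero (Suc m - j) 0)"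
      using sum_paths_to_zero[OF ev] by simp
    moreover have "(\<Sum>j\<in>{..Suc m} - {0} - {Suc m}. ?W (Suc m) 0 j)
        = (\<Sum>j\<in>{..Suc m} - {0} - {Suc m}. paths_to_zero j 0 * paths_to_zero (Suc m - j) 0)"
      by (rule sum.cong) (use inner in auto)
    ultimately have "?W (Suc m) 0 0 + ?W (Suc m) 0 (Suc m)
        = paths_to_zero 0 0 * paths_to_zero (Suc m) 0 + paths_to_zero (Suc m) 0 * paths_to_zero 0 0"
      by (simp add: sum.remove[of "{..Suc m}" 0] sum.remove[of "{..Suc m} - {0}" "Suc m"]
          del: sum.atMost_Suc num_paths_Suc)
    then have "?W (Suc m) 0 0 = paths_to_zero (Suc m) 0" "?W (Suc m) 0 (Suc m) = paths_to_zero (Suc m) 0"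
      using ends by (simp_all add: paths_to_zero_0)
    then show ?thesis
      using inner[of j] Suc.prems True by (cases "j = 0"; cases "j = Suc m") (auto simp: paths_to_zero_0)
  qed
qed

section \<open>The three statistics as functions of the sign sequence\<close>

definition last_zero_list :: "int list \<Rightarrow> nat" where
  "last_zero_list xs = Max {k. k \<le> length xs \<and> sum_list (take k xs) = 0}"

definition first_visit_list :: "int list \<Rightarrow> nat" where
  "first_visit_list xs = length xs - last_zero_list (rev xs)"

lemma last_zero_list_eq_iff: "last_zero_list xs = j \<longleftrightarrow> is_last_zero 0 xs j"
  using is_last_zero_Max[of xs] is_last_zero_unique unfolding last_zero_list_def by metis

lemma last_zero_list_le: "last_zero_list xs \<le> length xs"
  using last_zero_list_eq_iff[of xs "last_zero_list xs"] by (simp add: is_last_zero_def)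

lemma discrete_arcsine_last_zero: "even m \<Longrightarrow> discrete_arcsine m last_zero_list"
  using last_zero_list_le
  by (auto simp: discrete_arcsine_def last_zero_list_eq_iff num_paths_last_zero sign_lists_def)

lemma discrete_arcsine_above: "even m \<Longrightarrow> discrete_arcsine m (above 0)"
  using above_le[of 0] by (auto simp: discrete_arcsine_def num_paths_above sign_lists_def)

text \<open>The first visit of a walk to its end point is, seen from the end, the last zero. The law is
  symmetric under \<open>j \<mapsto> m - j\<close>.\<close>
lemma discrete_arcsine_first_visit:
  assumes "even m"
  shows "discrete_arcsine m first_visit_list"
proof -
  have "num_paths m (\<lambda>xs. first_visit_list xs = j) = paths_to_zero j 0 * paths_to_zero (m - j) 0" if "j \<le> m" for j
  proof -
    have "num_paths m (\<lambda>xs. first_visit_list xs = j)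
        = num_paths m (\<lambda>xs. last_zero_list (rev xs) = m - j)"
    proof (rule num_paths_cong)
      fix xs assume "xs \<in> sign_lists m"
      then show "first_visit_list xs = j \<longleftrightarrow> last_zero_list (rev xs) = m - j"
        using last_zero_list_le[of "rev xs"] that by (auto simp: first_visit_list_def sign_lists_def)
    qed
    also have "\<dots> = num_paths m (\<lambda>xs. last_zero_list xs = m - j)"
      by (rule num_paths_rev)
    finally show ?thesis
      using discrete_arcsine_last_zero[OF assms] that by (simp add: discrete_arcsine_def)
  qed
  then show ?thesis
    by (auto simp: discrete_arcsine_def sign_lists_def first_visit_list_def)
qed

lemma sum_sign_lists_discrete_arcsine:
  fixes H :: "nat \<Rightarrow> real"
  assumes "discrete_arcsine (2 * n) f"
  shows "(\<Sum>xs\<in>sign_lists (2 * n). H (f xs)) / 2 ^ (2 * n)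
    = (\<Sum>k\<le>n. return_prob k * return_prob (n - k) * H (2 * k))"
proof -
  have "(\<Sum>xs\<in>sign_lists (2 * n). H (f xs))
      = (\<Sum>j\<le>2 * n. real (card {xs \<in> sign_lists (2 * n). f xs = j}) * H j)"
    by (rule sum_fun_comp) (use assms in \<open>auto simp: discrete_arcsine_def\<close>)
  also have "\<dots> = (\<Sum>j\<le>2 * n. real (paths_to_zero j 0 * paths_to_zero (2 * n - j) 0) * H j)"
    using assms by (intro sum.cong) (auto simp: discrete_arcsine_def num_paths_def)
  also have "\<dots> = (\<Sum>k\<le>n. real (paths_to_zero (2 * k) 0 * paths_to_zero (2 * n - 2 * k) 0) * H (2 * k))"
    by (rule sum_even_support) (simp add: paths_to_zero_odd)
  also have "\<dots> = 2 ^ (2 * n) * (\<Sum>k\<le>n. return_prob k * return_prob (n - k) * H (2 * k))"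
    unfolding sum_distrib_left
    by (rule sum.cong) (simp_all only: paths_to_zero_prod atMost_iff power_mult mult.assoc, simp)
  finally show ?thesis by simp
qed

section \<open>From sign sequences to the random walk\<close>

context simple_random_walk
begin

definition steps :: "nat \<Rightarrow> 'a \<Rightarrow> int list" where
  "steps m \<omega> = map (\<lambda>i. X (Suc i) \<omega>) [0..<m]"

lemma length_steps [simp]: "length (steps m \<omega>) = m"
  by (simp add: steps_def)

lemma steps_eq_iff: "length xs = m \<Longrightarrow> steps m \<omega> = xs \<longleftrightarrow> (\<forall>i<m. X (Suc i) \<omega> = xs ! i)"
  by (auto simp: steps_def list_eq_iff_nth_eq)

lemma measurable_step [measurable]: "X (Suc i) \<in> M \<rightarrow>\<^sub>M count_space UNIV"
  using indep_steps by (auto simp: indep_vars_def)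

lemma steps_event: "{\<omega> \<in> space M. steps m \<omega> = xs} \<in> events"
proof (cases "length xs = m")
  case True
  then show ?thesis by (simp add: steps_eq_iff)
next
  case False
  then have "{\<omega> \<in> space M. steps m \<omega> = xs} = {}" by auto
  then show ?thesis by (simp only: sets.empty_sets)
qed

lemma measurable_steps [measurable]: "steps m \<in> M \<rightarrow>\<^sub>M count_space UNIV"
  using steps_event[of m]
  unfolding measurable_count_space_eq2_countable vimage_def Int_def
  by (simp add: conj_commute)

lemma prob_steps:
  assumes "xs \<in> sign_lists m"
  shows "prob {\<omega> \<in> space M. steps m \<omega> = xs} = 1 / 2 ^ m"
proof (cases "m = 0")
  case True
  with assms show ?thesis by (simp add: steps_def sign_lists_def prob_space)
next
  case False
  have len: "length xs = m" using assms by (simp add: sign_lists_def)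
  have step: "prob (X i -` {xs ! (i - 1)} \<inter> space M) = 1 / 2" if "i \<in> {1..m}" for i
  proof -
    have "xs ! (i - 1) \<in> {1, -1}"
    proof -
      have "xs ! (i - 1) \<in> set xs" using that len by (intro nth_mem) auto
      then show ?thesis using assms by (auto simp: sign_lists_def)
    qed
    moreover have "X i -` {c} \<inter> space M = {\<omega> \<in> space M. X i \<omega> = c}" for c by auto
    ultimately show ?thesis using prob_up[of i] prob_down[of i] that by auto
  qed
  have "{\<omega> \<in> space M. steps m \<omega> = xs} = (\<Inter>i\<in>{1..m}. X i -` {xs ! (i - 1)} \<inter> space M)"
  proof -
    have iff: "(\<forall>i\<in>{1..m}. X i \<omega> = xs ! (i - 1)) \<longleftrightarrow> steps m \<omega> = xs" for \<omega>
    proof -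
      have "(\<forall>i\<in>Suc ` {..<m}. X i \<omega> = xs ! (i - 1)) \<longleftrightarrow> (\<forall>i\<in>{..<m}. X (Suc i) \<omega> = xs ! i)"
        unfolding ball_simps by simp
      then show ?thesis
        unfolding image_Suc_lessThan steps_eq_iff[OF len] by blast
    qed
    have "{1..m} \<noteq> {}" using False by auto
    then have "(\<Inter>i\<in>{1..m}. X i -` {xs ! (i - 1)} \<inter> space M)
        = {\<omega> \<in> space M. \<forall>i\<in>{1..m}. X i \<omega> = xs ! (i - 1)}"
      by blast
    then show ?thesis unfolding iff by (rule sym)
  qed
  also have "prob \<dots> = (\<Prod>i\<in>{1..m}. prob (X i -` {xs ! (i - 1)} \<inter> space M))"
    by (rule indep_varsD[OF indep_steps]) (use False in auto)
  also have "\<dots> = (\<Prod>i\<in>{1..m}. 1 / 2)"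
    by (rule prod.cong[OF refl step])
  also have "\<dots> = 1 / 2 ^ m"
    by (simp add: power_one_over)
  finally show ?thesis .
qed

lemma AE_steps: "AE \<omega> in M. steps m \<omega> \<in> sign_lists m"
proof -
  have "prob (\<Union>xs\<in>sign_lists m. {\<omega> \<in> space M. steps m \<omega> = xs})
      = (\<Sum>xs\<in>sign_lists m. prob {\<omega> \<in> space M. steps m \<omega> = xs})"
    by (rule finite_measure_finite_Union) (auto simp: steps_event disjoint_family_on_def)
  also have "\<dots> = 1"
    by (simp add: prob_steps card_sign_lists)
  finally have "AE \<omega> in M. \<omega> \<in> (\<Union>xs\<in>sign_lists m. {\<omega> \<in> space M. steps m \<omega> = xs})"
    by (rule AE_prob_1)
  then show ?thesis by eventually_elim auto
qed

text \<open>The first \<open>m\<close> steps are almost surely uniformly distributed on the sign lists.\<close>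
lemma expectation_steps:
  fixes H :: "int list \<Rightarrow> real"
  shows "(\<integral>\<omega>. H (steps m \<omega>) \<partial>M) = (\<Sum>xs\<in>sign_lists m. H xs) / 2 ^ m"
proof -
  let ?E = "\<lambda>xs. {\<omega> \<in> space M. steps m \<omega> = xs}"
  note steps_event[measurable]
  have "(\<integral>\<omega>. H (steps m \<omega>) \<partial>M) = (\<integral>\<omega>. (\<Sum>xs\<in>sign_lists m. H xs * indicator (?E xs) \<omega>) \<partial>M)"
  proof (rule integral_cong_AE)
    show "AE \<omega> in M. H (steps m \<omega>) = (\<Sum>xs\<in>sign_lists m. H xs * indicator (?E xs) \<omega>)"
      using AE_steps[of m]  AE_space
    proof eventually_elim
      case (elim \<omega>)
      then have "(\<Sum>xs\<in>sign_lists m. H xs * indicator (?E xs) \<omega>)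
          = (\<Sum>xs\<in>sign_lists m. if steps m \<omega> = xs then H xs else 0)"
        by (intro sum.cong) (auto simp: indicator_def)
      with elim show ?case by simp
    qed
    show "(\<lambda>\<omega>. H (steps m \<omega>)) \<in> borel_measurable M"
      by (rule measurable_compose[OF measurable_steps]) simp
    show "(\<lambda>\<omega>. \<Sum>xs\<in>sign_lists m. H xs * indicator (?E xs) \<omega>) \<in> borel_measurable M"
      by measurable
  qed
  also have "\<dots> = (\<Sum>xs\<in>sign_lists m. H xs * prob (?E xs))"
    by (subst Bochner_Integration.integral_sum)
       (auto simp: steps_event intro!: integrable_real_indicator integrable_mult_right, simp add: emeasure_eq_measure)
  also have "\<dots> = (\<Sum>xs\<in>sign_lists m. H xs) / 2 ^ m"
    by (simp add: prob_steps sum_divide_distrib)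
  finally show ?thesis .
qed

lemma walk_eq_sum_list: "k \<le> m \<Longrightarrow> walk X k \<omega> = sum_list (take k (steps m \<omega>))"
proof -
  assume "k \<le> m"
  then have "take k (steps m \<omega>) = steps k \<omega>" by (simp add: steps_def take_map)
  then show ?thesis
    by (simp add: walk_def steps_def sum_list_distinct_conv_sum_set interv_sum_list_conv_sum_set_nat
        sum.atLeast1_atMost_eq atLeast0LessThan del: upt_Suc)
qed

lemma last_zero_eq: "last_zero X m \<omega> = last_zero_list (steps m \<omega>)"
proof -
  have "{k. k \<le> m \<and> walk X k \<omega> = 0} = {k. k \<le> m \<and> sum_list (take k (steps m \<omega>)) = 0}"
    using walk_eq_sum_list[of _ m \<omega>] by auto
  moreover have "Sup A = Max A" if "finite A" "0 \<in> A" for A :: "nat set"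
    using that by (intro cSup_eq_Max) auto
  ultimately show ?thesis
    unfolding last_zero_def last_zero_list_def length_steps by simp
qed

lemma first_visit_end_eq: "first_visit_end X m \<omega> = first_visit_list (steps m \<omega>)"
proof -
  let ?J = "last_zero_list (rev (steps m \<omega>))"
  have rev: "sum_list (take k (rev (steps m \<omega>))) = walk X m \<omega> - walk X (m - k) \<omega>" if "k \<le> m" for k
  proof -
    have "sum_list (take (m - k) (steps m \<omega>)) + sum_list (drop (m - k) (steps m \<omega>))
        = sum_list (steps m \<omega>)"
      by (metis append_take_drop_id sum_list_append)
    then show ?thesis
      using walk_eq_sum_list[of m m \<omega>] walk_eq_sum_list[of "m - k" m \<omega>]
      by (simp add: take_rev)
  qed
  have J: "is_last_zero 0 (rev (steps m \<omega>)) ?J" by (simp flip: last_zero_list_eq_iff)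
  then have "?J \<le> m" by (simp add: is_last_zero_def)
  have "Inf {k. walk X k \<omega> = walk X m \<omega>} = m - ?J"
  proof (rule cInf_eq_minimum)
    show "m - ?J \<in> {k. walk X k \<omega> = walk X m \<omega>}"
      using J rev[of ?J] by (simp add: is_last_zero_def)
    fix s assume s: "s \<in> {k. walk X k \<omega> = walk X m \<omega>}"
    show "m - ?J \<le> s"
    proof (rule ccontr)
      assume "\<not> m - ?J \<le> s"
      then have "?J < m - s" by simp
      with J have "sum_list (take (m - s) (rev (steps m \<omega>))) \<noteq> 0" by (simp add: is_last_zero_def)
      then show False using s rev[of "m - s"] \<open>\<not> m - ?J \<le> s\<close> by simp
    qed
  qed
  then show ?thesis by (simp add: first_visit_end_def first_visit_list_def)
qed

lemma segments_above_eq: "segments_above X m \<omega> = above 0 (steps m \<omega>)"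
  unfolding segments_above_def above_eq_card
  by (rule arg_cong[where f = card], rule Collect_cong) (use walk_eq_sum_list[of _ m \<omega>] in auto)

lemma expectation_discrete_arcsine:
  fixes h :: "real \<Rightarrow> real"
  assumes "discrete_arcsine (2 * n) f" "\<And>\<omega>. S \<omega> = f (steps (2 * n) \<omega>)"
  shows "(\<integral>\<omega>. h (real (S \<omega>) / (2 * real n)) \<partial>M)
    = (\<Sum>k\<le>n. arcsine_pmf n k * h (real k / real n))"
  unfolding arcsine_pmf_def assms(2) expectation_steps[of "\<lambda>xs. h (real (f xs) / (2 * real n))"]
    sum_sign_lists_discrete_arcsine[OF assms(1), of "\<lambda>j. h (real j / (2 * real n))"]
  by (rule sum.cong) simp_all

end

section \<open>Bounds on the central binomial probabilities\<close>

lemma wallis_return_prob: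
  "(\<Prod>k=1..n. (4 * real k ^ 2) / (4 * real k ^ 2 - 1)) = 1 / ((return_prob n)\<^sup>2 * (2 * real n + 1))"
proof (induction n)
  case (Suc n)
  have pos: "return_prob n > 0" by (rule return_prob_pos)
  have "4 * (real (Suc n))\<^sup>2 - 1 = (2 * real n + 1) * (2 * real n + 3)"
    by (simp add: power2_eq_square algebra_simps)
  moreover have "4 * (real (Suc n))\<^sup>2 = (2 * real n + 2)\<^sup>2"
    by (simp add: power2_eq_square algebra_simps)
  ultimately have "(\<Prod>k=1..Suc n. (4 * real k ^ 2) / (4 * real k ^ 2 - 1))
      = 1 / ((return_prob n)\<^sup>2 * (2 * real n + 1)) * ((2 * real n + 2)\<^sup>2 / ((2 * real n + 1) * (2 * real n + 3)))"
    using Suc by simp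
  also have "\<dots> = 1 / ((return_prob n * (2 * real n + 1) / (2 * real n + 2))\<^sup>2 * (2 * real n + 3))"
    unfolding power_divide power_mult_distrib by (simp add: power2_eq_square)
  finally show ?case by (simp add: return_prob_Suc algebra_simps)
qed simp

lemma tendsto_return_prob: "(\<lambda>n. (return_prob n)\<^sup>2 * (2 * real n + 1)) \<longlonglongrightarrow> 2 / pi"
  using tendsto_inverse[OF wallis] unfolding wallis_return_prob by simp

text \<open>By Wallis' product, \<open>(return_prob n)\<^sup>2 * (2 * n + 1)\<close> decreases to \<open>2 / \<pi>\<close>.\<close>
lemma return_prob_lower: "1 / sqrt (pi * (real n + 1 / 2)) \<le> return_prob n"
proof -
  have "decseq (\<lambda>n. (return_prob n)\<^sup>2 * (2 * real n + 1))"
  proof (rule decseq_SucI)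
    fix n
    have "(return_prob (Suc n))\<^sup>2 * (2 * real (Suc n) + 1)
        = (return_prob n)\<^sup>2 * (2 * real n + 1) * ((2 * real n + 1) * (2 * real n + 3) / (2 * real n + 2)\<^sup>2)"
      by (simp add: return_prob_Suc power_divide power_mult_distrib power2_eq_square algebra_simps)
    also have "\<dots> \<le> (return_prob n)\<^sup>2 * (2 * real n + 1) * 1"
    proof (rule mult_left_mono)
      have "(2 * real n + 1) * (2 * real n + 3) \<le> (2 * real n + 2)\<^sup>2"
        by (simp add: power2_eq_square algebra_simps)
      then show "(2 * real n + 1) * (2 * real n + 3) / (2 * real n + 2)\<^sup>2 \<le> 1"
        by (rule divide_le_eq_1_pos[THEN iffD2, rotated]) simp
    qed simp
    finally show "(return_prob (Suc n))\<^sup>2 * (2 * real (Suc n) + 1) \<le> (return_prob n)\<^sup>2 * (2 * real n + 1)"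
      by simp
  qed
  from decseq_ge[OF this tendsto_return_prob, of n] have "2 / pi / (2 * real n + 1) \<le> (return_prob n)\<^sup>2"
    by (subst pos_divide_le_eq) auto
  also have "2 / pi / (2 * real n + 1) = 1 / (pi * ((2 * real n + 1) / 2))" by simp
  also have "(2 * real n + 1) / 2 = real n + 1 / 2" by simp
  finally have "1 / (pi * (real n + 1 / 2)) \<le> (return_prob n)\<^sup>2" .
  then have "sqrt (1 / (pi * (real n + 1 / 2))) \<le> sqrt ((return_prob n)\<^sup>2)"
    by (rule real_sqrt_le_mono)
  then show ?thesis
    using return_prob_pos[of n] by (simp add: real_sqrt_divide)
qed

text \<open>Replacing the factor \<open>2 * n + 1\<close> by \<open>2 * n\<close> keeps the limit but turns the sequence into
  an increasing one.\<close>
lemma return_prob_upper: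
  assumes "n > 0"
  shows "return_prob n \<le> 1 / sqrt (pi * real n)"
proof -
  have "incseq (\<lambda>n. (return_prob n)\<^sup>2 * (2 * real n))"
  proof (rule incseq_SucI)
    fix n
    have "(2 * real n) * (2 * real n + 2) \<le> (2 * real n + 1)\<^sup>2"
      by (simp add: power2_eq_square algebra_simps)
    then have "2 * real n \<le> (2 * real n + 1)\<^sup>2 / (2 * real n + 2)"
      by (simp add: pos_le_divide_eq)
    then have "(return_prob n)\<^sup>2 * (2 * real n) \<le> (return_prob n)\<^sup>2 * ((2 * real n + 1)\<^sup>2 / (2 * real n + 2))"
      by (rule mult_left_mono) simp
    also have "\<dots> = (return_prob n * (2 * real n + 1) / (2 * real n + 2))\<^sup>2 * (2 * real n + 2)"
      by (simp add: power_divide power_mult_distrib) (simp add: power2_eq_square)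
    finally show "(return_prob n)\<^sup>2 * (2 * real n) \<le> (return_prob (Suc n))\<^sup>2 * (2 * real (Suc n))"
      by (simp add: return_prob_Suc algebra_simps)
  qed
  moreover have "(\<lambda>n. (return_prob n)\<^sup>2 * (2 * real n)) \<longlonglongrightarrow> 2 / pi"
  proof -
    have "(\<lambda>n. 2 * real n / (2 * real n + 1)) \<longlonglongrightarrow> 1"
      using LIMSEQ_subseq_LIMSEQ[OF LIMSEQ_n_over_Suc_n[where 'a = real], of "\<lambda>n. 2 * n"]
      by (simp add: strict_mono_def o_def add.commute)
    from tendsto_mult[OF tendsto_return_prob this] show ?thesis
      by (simp add: add_nonneg_eq_0_iff)
  qed
  ultimately have "(return_prob n)\<^sup>2 * (2 * real n) \<le> 2 / pi"
    by (rule incseq_le)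
  then have "(return_prob n)\<^sup>2 \<le> 1 / (pi * real n)"
    using assms by (simp add: field_simps)
  then have "sqrt ((return_prob n)\<^sup>2) \<le> sqrt (1 / (pi * real n))"
    by (rule real_sqrt_le_mono)
  then show ?thesis
    using return_prob_pos[of n] by (simp add: real_sqrt_divide)
qed

section \<open>The arcsine distribution function and its inverse\<close>

definition arcsine_cdf :: "real \<Rightarrow> real" where
  "arcsine_cdf x = 2 / pi * arcsin (sqrt x)"

definition arcsine_quantile :: "real \<Rightarrow> real" where
  "arcsine_quantile v = (sin (pi / 2 * v))\<^sup>2"

lemma arcsine_density_nonneg: "arcsine_density x \<ge> 0"
  by (simp add: arcsine_density_def)

lemma arcsine_density_mono:
  assumes "0 < x" "x < 1" "x * (1 - x) \<le> y * (1 - y)"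
  shows "arcsine_density y \<le> arcsine_density x"
proof (cases "0 < y \<and> y < 1")
  case True
  then show ?thesis using assms
    by (auto simp: arcsine_density_def intro!: divide_left_mono mult_left_mono mult_pos_pos real_sqrt_le_mono)
qed (use arcsine_density_nonneg in \<open>auto simp: arcsine_density_def\<close>)

lemma arcsine_cdf_deriv:
  assumes "0 < x" "x < 1"
  shows "(arcsine_cdf has_real_derivative arcsine_density x) (at x)"
proof -
  have "((\<lambda>x. 2 / pi * arcsin (sqrt x)) has_real_derivative
      2 / pi * (inverse (sqrt (1 - (sqrt x)\<^sup>2)) * (inverse (sqrt x) / 2))) (at x)"
    using assms
    by (intro DERIV_cmult DERIV_chain'[where g = arcsin] DERIV_real_sqrt DERIV_arcsin) (auto intro: less_le_trans[of _ 0])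
  also have "2 / pi * (inverse (sqrt (1 - (sqrt x)\<^sup>2)) * (inverse (sqrt x) / 2)) = arcsine_density x"
    using assms by (simp add: arcsine_density_def real_sqrt_mult inverse_eq_divide)
  finally show ?thesis by (simp add: arcsine_cdf_def[abs_def])
qed

lemma arcsine_cdf_continuous: "continuous_on {0..1} arcsine_cdf"
  unfolding arcsine_cdf_def
  by (intro continuous_intros) (auto intro: order_trans[of _ 0])

lemma arcsine_cdf_mono: "0 \<le> x \<Longrightarrow> x \<le> y \<Longrightarrow> y \<le> 1 \<Longrightarrow> arcsine_cdf x \<le> arcsine_cdf y"
  unfolding arcsine_cdf_def
  by (intro mult_left_mono arcsin_le_arcsin) (auto intro: order_trans[of _ 0])

lemma arcsine_cdf_bounds: "0 \<le> x \<Longrightarrow> x \<le> 1 \<Longrightarrow> 0 \<le> arcsine_cdf x \<and> arcsine_cdf x \<le> 1"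
  using arcsine_cdf_mono[of 0 x] arcsine_cdf_mono[of x 1] by (simp add: arcsine_cdf_def)

lemma arcsine_cdf_reflect:
  assumes "0 \<le> x" "x \<le> 1"
  shows "arcsine_cdf (1 - x) = 1 - arcsine_cdf x"
proof -
  let ?t = "arcsin (sqrt x)"
  have x: "0 \<le> sqrt x" "sqrt x \<le> 1" using assms by auto
  have t: "0 \<le> ?t" "?t \<le> pi / 2"
    using arcsin_le_arcsin[of 0 "sqrt x"] arcsin_bounded[of "sqrt x"] x by auto
  have "sqrt (1 - x) = sin (pi / 2 - ?t)"
    using cos_arcsin[of "sqrt x"] x assms by (simp add: sin_diff)
  then have "arcsin (sqrt (1 - x)) = pi / 2 - ?t"
    using t by (simp add: arcsin_sin)
  then show ?thesis by (simp add: arcsine_cdf_def field_simps)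
qed

lemma arcsine_quantile_mono:
  assumes "0 \<le> u" "u \<le> v" "v \<le> 1"
  shows "arcsine_quantile u \<le> arcsine_quantile v"
proof -
  have "pi / 2 * u \<le> pi / 2 * v" "pi / 2 * v \<le> pi / 2 * 1" "0 \<le> pi / 2 * u"
    using assms by (intro mult_left_mono mult_nonneg_nonneg; simp)+
  then show ?thesis
    unfolding arcsine_quantile_def
    by (intro power_mono sin_monotone_2pi_le sin_ge_zero) (use pi_gt_zero in linarith)+
qed

lemma arcsine_quantile_bounds: "0 \<le> arcsine_quantile v" "arcsine_quantile v \<le> 1"
  unfolding arcsine_quantile_def by (simp_all add: abs_square_le_1 abs_sin_le_one)

lemma arcsine_cdf_quantile:
  assumes "0 \<le> v" "v \<le> 1"
  shows "arcsine_cdf (arcsine_quantile v) = v"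
proof -
  have "pi / 2 * v \<le> pi / 2 * 1" "0 \<le> pi / 2 * v"
    using assms by (intro mult_left_mono mult_nonneg_nonneg; simp)+
  then have "sin (pi / 2 * v) \<ge> 0" "arcsin (sin (pi / 2 * v)) = pi / 2 * v"
    using pi_gt_zero by (intro sin_ge_zero arcsin_sin; linarith)+
  moreover from this have "sqrt ((sin (pi / 2 * v))\<^sup>2) = sin (pi / 2 * v)" by simp
  ultimately show ?thesis
    unfolding arcsine_cdf_def arcsine_quantile_def by (simp add: field_simps)
qed

lemma arcsine_quantile_cdf:
  assumes "0 \<le> x" "x \<le> 1"
  shows "arcsine_quantile (arcsine_cdf x) = x"
proof -
  have "sin (arcsin (sqrt x)) = sqrt x"
    using assms by (intro sin_arcsin) (auto intro: order_trans[of _ 0])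
  with assms show ?thesis by (simp add: arcsine_cdf_def arcsine_quantile_def)
qed

lemma arcsine_cdf_MVT:
  assumes "0 \<le> a" "a < b" "b \<le> 1"
  obtains z where "a < z" "z < b" "arcsine_cdf b - arcsine_cdf a = (b - a) * arcsine_density z"
proof -
  have "continuous_on {a..b} arcsine_cdf"
    by (rule continuous_on_subset[OF arcsine_cdf_continuous]) (use assms in auto)
  moreover have "(arcsine_cdf has_real_derivative arcsine_density x) (at x)" if "a < x" "x < b" for x
    using arcsine_cdf_deriv[of x] that assms by simp
  ultimately show ?thesis
    using MVT[OF assms(2), of arcsine_cdf] DERIV_unique that
    by (metis real_differentiable_def)
qed

text \<open>Left of \<open>1/2\<close> the density decreases, so on an interval its least value is the one at the right end.\<close>
lemma arcsine_cdf_diff_ge: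
  assumes "0 \<le> a" "a < b" "b \<le> 1 / 2"
  shows "(b - a) * arcsine_density b \<le> arcsine_cdf b - arcsine_cdf a"
proof -
  obtain z where z: "a < z" "z < b" "arcsine_cdf b - arcsine_cdf a = (b - a) * arcsine_density z"
    using arcsine_cdf_MVT[of a b] assms by auto
  have "(b - z) * (1 - b - z) \<ge> 0" using z assms by (intro mult_nonneg_nonneg) auto
  then have "arcsine_density b \<le> arcsine_density z"
    using z assms by (intro arcsine_density_mono) (auto simp: algebra_simps)
  then show ?thesis unfolding z(3) using assms by (intro mult_left_mono) auto
qed

text \<open>The density is symmetric about \<open>1/2\<close> and increases with the distance from it. The condition
  \<open>a + b \<ge> 1\<close> says that \<open>b\<close> is the end point that is farther from \<open>1/2\<close>, so the density is largest there.\<close>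
lemma arcsine_cdf_diff_le:
  assumes "0 \<le> a" "a < b" "b < 1" "a + b \<ge> 1"
  shows "arcsine_cdf b - arcsine_cdf a \<le> (b - a) * arcsine_density b"
proof -
  obtain z where z: "a < z" "z < b" "arcsine_cdf b - arcsine_cdf a = (b - a) * arcsine_density z"
    using arcsine_cdf_MVT[of a b] assms by auto
  have "(b - z) * (b + z - 1) \<ge> 0" using z assms by (intro mult_nonneg_nonneg) auto
  then have "arcsine_density z \<le> arcsine_density b"
    using z assms by (intro arcsine_density_mono) (auto simp: algebra_simps)
  then show ?thesis unfolding z(3) using assms by (intro mult_left_mono) auto
qed

section \<open>Comparing the discrete with the continuous distribution function\<close>

text \<open>The bound \<open>k\<close> is exclusive, so that the value at \<open>0\<close> is \<open>0\<close> and the value at \<open>Suc n\<close> is \<open>1\<close>: for a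
  variable with weights \<open>arcsine_pmf n\<close> this is the probability of being less than \<open>k\<close>.\<close>
definition arcsine_sum :: "nat \<Rightarrow> nat \<Rightarrow> real" where
  "arcsine_sum n k = (\<Sum>j<k. arcsine_pmf n j)"

lemma arcsine_pmf_pos: "arcsine_pmf n k > 0"
  by (simp add: arcsine_pmf_def return_prob_pos)

lemma arcsine_sum_Suc: "arcsine_sum n (Suc k) = arcsine_sum n k + arcsine_pmf n k"
  by (simp add: arcsine_sum_def)

lemma arcsine_sum_mono: "j \<le> k \<Longrightarrow> arcsine_sum n j \<le> arcsine_sum n k"
  unfolding arcsine_sum_def by (intro sum_mono2) (auto intro: less_imp_le[OF arcsine_pmf_pos])

lemma arcsine_sum_total: "arcsine_sum n (Suc n) = 1"
  using sum_return_prob[of n] by (simp add: arcsine_sum_def arcsine_pmf_def lessThan_Suc_atMost)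

lemma arcsine_sum_reflect: "k \<le> Suc n \<Longrightarrow> arcsine_sum n (Suc n - k) = 1 - arcsine_sum n k"
proof (induction k)
  case 0
  then show ?case using arcsine_sum_total[of n] by (simp add: arcsine_sum_def)
next
  case (Suc k)
  then have "arcsine_pmf n (n - k) = arcsine_pmf n k" by (simp add: arcsine_pmf_def)
  then show ?case
    using Suc arcsine_sum_Suc[of n "n - k"] arcsine_sum_Suc[of n k] by (simp add: Suc_diff_le)
qed

lemma arcsine_sum_bounds: "k \<le> Suc n \<Longrightarrow> 0 \<le> arcsine_sum n k \<and> arcsine_sum n k \<le> 1"
  using arcsine_sum_mono[of 0 k n] arcsine_sum_mono[of k "Suc n" n] arcsine_sum_total[of n]
  by (simp add: arcsine_sum_def)

lemma arcsine_sum_middle: "1 / 2 \<le> arcsine_sum n (Suc (n div 2))"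
proof -
  \<comment> \<open>By symmetry the two sides of this inequality add up to \<open>1\<close>.\<close>
  have "arcsine_sum n (Suc n - Suc (n div 2)) \<le> arcsine_sum n (Suc (n div 2))"
    by (rule arcsine_sum_mono) linarith
  then show ?thesis using arcsine_sum_reflect[of "Suc (n div 2)" n] by simp
qed

lemma arcsine_cdf_half: "x \<ge> 0 \<Longrightarrow> x \<le> 1 / 2 \<Longrightarrow> arcsine_cdf x \<le> 1 / 2"
  using arcsine_cdf_mono[of x "1/2"] arcsine_cdf_reflect[of "1/2"] by simp

lemma arcsine_pmf_le:
  assumes "0 < k" "k < n"
  shows "arcsine_pmf n k \<le> 1 / real n * arcsine_density (real k / real n)"
proof -
  have "arcsine_pmf n k \<le> 1 / sqrt (pi * real k) * (1 / sqrt (pi * real (n - k)))"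
    unfolding arcsine_pmf_def using assms
    by (intro mult_mono return_prob_upper) (auto intro: less_imp_le[OF return_prob_pos])
  also have "\<dots> = 1 / (pi * sqrt (real k * (real n - real k)))"
    using assms by (simp add: real_sqrt_mult of_nat_diff)
  also have "\<dots> = 1 / (real n * (pi * sqrt (real k * (real n - real k) / (real n)\<^sup>2)))"
    using assms by (simp add: real_sqrt_divide)
  also have "real k * (real n - real k) / (real n)\<^sup>2 = real k / real n * (1 - real k / real n)"
    using assms by (simp add: field_simps power2_eq_square)
  finally show ?thesis using assms by (simp add: arcsine_density_def)
qed

lemma arcsine_pmf_ge:
  assumes "k \<le> n"
  shows "1 / (real n + 1) * arcsine_density ((real k + 1 / 2) / (real n + 1)) \<le> arcsine_pmf n k"
proof -
  let ?x = "(real k + 1 / 2) / (real n + 1)"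
  have nk: "real (n - k) = real n - real k" using assms by simp
  have "?x * (1 - ?x) = (real k + 1 / 2) * (real n - real k + 1 / 2) / (real n + 1)\<^sup>2"
    by (simp add: field_simps power2_eq_square)
  then have "1 / (real n + 1) * arcsine_density ?x
      = 1 / ((real n + 1) * (pi * sqrt ((real k + 1 / 2) * (real n - real k + 1 / 2) / (real n + 1)\<^sup>2)))"
    using assms by (simp add: arcsine_density_def)
  also have "\<dots> = 1 / (pi * sqrt ((real k + 1 / 2) * (real n - real k + 1 / 2)))"
    by (simp add: real_sqrt_divide)
  also have "\<dots> = 1 / sqrt (pi * (real k + 1 / 2)) * (1 / sqrt (pi * (real (n - k) + 1 / 2)))"
    unfolding nk by (simp add: real_sqrt_mult)
  also have "\<dots> \<le> arcsine_pmf n k"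
    unfolding arcsine_pmf_def
    by (intro mult_mono return_prob_lower) (auto intro: less_imp_le[OF return_prob_pos])
  finally show ?thesis .
qed

text \<open>At \<open>n div 2\<close> the claim holds as the two sides are separated by \<open>1/2\<close>. Going down from there, the
  right-hand side loses a weight, which is at most the loss of the left-hand side.\<close>
lemma arcsine_sum_ge_lower_half:
  assumes "k \<le> n div 2" "n \<ge> 1"
  shows "arcsine_cdf (real k / real n) \<le> arcsine_sum n (Suc k)"
  using assms(1)
proof (induction rule: inc_induct)
  case base
  have "arcsine_cdf (real (n div 2) / real n) \<le> 1 / 2"
    using assms by (intro arcsine_cdf_half) (auto simp: field_simps simp flip: of_nat_mult)
  then show ?case using arcsine_sum_middle[of n] by simp
next
  case (step k)
  have "2 * Suc k \<le> n" using step(2) by presburger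
  then have lt: "Suc k < n" and "2 * real (Suc k) \<le> real n" by auto
  then have le: "real (Suc k) / real n \<le> 1 / 2" by (simp add: divide_le_eq)
  have "arcsine_pmf n (Suc k) \<le> 1 / real n * arcsine_density (real (Suc k) / real n)"
    using lt by (intro arcsine_pmf_le) auto
  also have "\<dots> = (real (Suc k) / real n - real k / real n) * arcsine_density (real (Suc k) / real n)"
    unfolding diff_divide_distrib[symmetric] by simp
  also have "\<dots> \<le> arcsine_cdf (real (Suc k) / real n) - arcsine_cdf (real k / real n)"
    by (rule arcsine_cdf_diff_ge) (use le assms in \<open>auto simp: divide_strict_right_mono\<close>)
  finally show ?case
    using step.IH arcsine_sum_Suc[of n "Suc k"] by simp
qed

text \<open>Going up from the middle, the weight gained by the right-hand side has to be at least the gain of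
  the left-hand side. On the scale \<open>k / n\<close> this argument would need the lower bound \<open>1 / (\<pi> * sqrt (k * (n - k)))\<close> on the
  weights, which is false; shifting both factors by \<open>1/2\<close>, as in \<open>return_prob_lower\<close>, amounts to
  replacing the interval \<open>{0..n}\<close> by one that is longer by \<open>1/2\<close> on each side.\<close>
lemma arcsine_sum_ge_upper_half:
  assumes "n div 2 \<le> k" "k \<le> n"
  shows "arcsine_cdf ((real k + 1 / 2) / (real n + 1)) \<le> arcsine_sum n (Suc k)"
  using assms
proof (induction rule: dec_induct)
  case base
  have "2 * real (n div 2) \<le> real n" by linarith
  then have "arcsine_cdf ((real (n div 2) + 1 / 2) / (real n + 1)) \<le> 1 / 2"
    by (intro arcsine_cdf_half) (auto simp: field_simps)
  then show ?case using arcsine_sum_middle[of n] by simp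
next
  case (step k)
  have "n \<le> 2 * k + 1" and k: "Suc k \<le> n" using step by linarith+
  then have nk: "real n \<le> 2 * real k + 1" by linarith
  let ?a = "(real k + 1 / 2) / (real n + 1)" and ?b = "(real (Suc k) + 1 / 2) / (real n + 1)"
  have "?a + ?b = (2 * real k + 2) / (real n + 1)"
    unfolding add_divide_distrib[symmetric] by simp
  also have "\<dots> \<ge> 1" using nk by (simp add: le_divide_eq)
  finally have "1 \<le> ?a + ?b" .
  then have "arcsine_cdf ?b - arcsine_cdf ?a \<le> (?b - ?a) * arcsine_density ?b"
    using k by (intro arcsine_cdf_diff_le) (auto simp: divide_strict_right_mono)
  also have "?b - ?a = 1 / (real n + 1)" unfolding diff_divide_distrib[symmetric] by simp
  also have "1 / (real n + 1) * arcsine_density ?b \<le> arcsine_pmf n (Suc k)"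
    by (rule arcsine_pmf_ge[OF k])
  finally show ?case
    using step.IH k arcsine_sum_Suc[of n "Suc k"] by simp
qed

text \<open>The argument \<open>(k - 1) / n\<close> is below both \<open>k / n\<close> and \<open>(k + 1/2) / (n + 1)\<close>, at which the two halves have
  been compared.\<close>
lemma arcsine_sum_ge:
  assumes "1 \<le> k" "k \<le> n"
  shows "arcsine_cdf ((real k - 1) / real n) \<le> arcsine_sum n (Suc k)"
proof (cases "k \<le> n div 2")
  case True
  have "arcsine_cdf ((real k - 1) / real n) \<le> arcsine_cdf (real k / real n)"
    using assms by (intro arcsine_cdf_mono divide_right_mono) auto
  also have "\<dots> \<le> arcsine_sum n (Suc k)"
    using True assms by (intro arcsine_sum_ge_lower_half) auto
  finally show ?thesis .
next
  case False
  have "(real k - 1) / real n \<le> (real k + 1 / 2) / (real n + 1)"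
    using assms by (simp add: field_simps)
  then have "arcsine_cdf ((real k - 1) / real n) \<le> arcsine_cdf ((real k + 1 / 2) / (real n + 1))"
    using assms by (intro arcsine_cdf_mono) auto
  also have "\<dots> \<le> arcsine_sum n (Suc k)"
    using False assms by (intro arcsine_sum_ge_upper_half) auto
  finally show ?thesis .
qed

lemma arcsine_sum_le:
  assumes "k + 2 \<le> n"
  shows "arcsine_sum n (Suc k) \<le> arcsine_cdf ((real k + 2) / real n)"
proof -
  have "arcsine_cdf ((real (n - k - 1) - 1) / real n) \<le> arcsine_sum n (Suc (n - k - 1))"
    using assms by (intro arcsine_sum_ge) auto
  also have "Suc (n - k - 1) = Suc n - Suc k" using assms by simp
  also have "arcsine_sum n (Suc n - Suc k) = 1 - arcsine_sum n (Suc k)"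
    using assms by (intro arcsine_sum_reflect) auto
  also have "(real (n - k - 1) - 1) / real n = 1 - (real k + 2) / real n"
    using assms by (simp add: field_simps of_nat_diff)
  also have "arcsine_cdf (1 - (real k + 2) / real n) = 1 - arcsine_cdf ((real k + 2) / real n)"
    using assms by (intro arcsine_cdf_reflect) auto
  finally show ?thesis by simp
qed

text \<open>The end points of the intervals on which the monotone coupling is constant: \<open>K = k\<close> exactly when
  \<open>Z\<close> lies between \<open>arcsine_cut n k\<close> and \<open>arcsine_cut n (Suc k)\<close>.\<close>
definition arcsine_cut :: "nat \<Rightarrow> nat \<Rightarrow> real" where
  "arcsine_cut n k = arcsine_quantile (arcsine_sum n k)"

lemma arcsine_cut_upper:
  assumes "n \<ge> 1" "k \<le> n"
  shows "arcsine_cut n (Suc k) \<le> (real k + 2) / real n"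
proof (cases "k + 2 \<le> n")
  case True
  then have r: "0 \<le> (real k + 2) / real n" "(real k + 2) / real n \<le> 1" by auto
  have "arcsine_cut n (Suc k) \<le> arcsine_quantile (arcsine_cdf ((real k + 2) / real n))"
    unfolding arcsine_cut_def
    using arcsine_sum_le[OF True] arcsine_sum_bounds[of "Suc k" n] arcsine_cdf_bounds[OF r] assms
    by (intro arcsine_quantile_mono) auto
  then show ?thesis by (simp only: arcsine_quantile_cdf[OF r])
next
  case False
  then have "1 \<le> (real k + 2) / real n" using assms by (simp add: le_divide_eq)
  then show ?thesis
    using arcsine_quantile_bounds(2)[of "arcsine_sum n (Suc k)"] unfolding arcsine_cut_def by linarith
qed

lemma arcsine_cut_lower:
  assumes "n \<ge> 1" "k \<le> n"
  shows "(real k - 2) / real n \<le> arcsine_cut n k"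
proof (cases "k \<ge> 2")
  case True
  define l where "l = k - 1"
  have l: "k = Suc l" "1 \<le> l" "l \<le> n" using True assms by (auto simp: l_def)
  have r: "0 \<le> (real l - 1) / real n" "(real l - 1) / real n \<le> 1" using l by (auto simp: divide_le_eq)
  have "arcsine_quantile (arcsine_cdf ((real l - 1) / real n)) \<le> arcsine_cut n k"
    unfolding arcsine_cut_def l(1)
    using arcsine_sum_ge[OF l(2,3)] arcsine_sum_bounds[of "Suc l" n] arcsine_cdf_bounds[OF r] l
    by (intro arcsine_quantile_mono) auto
  then show ?thesis unfolding arcsine_quantile_cdf[OF r] l(1) by simp
next
  case False
  then have "(real k - 2) / real n \<le> 0" by (simp add: divide_le_0_iff)
  then show ?thesis
    using arcsine_quantile_bounds(1)[of "arcsine_sum n k"] unfolding arcsine_cut_def by linarith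
qed

section \<open>The quantile coupling\<close>

lemma arcsine_distributed_cdf:
  assumes "arcsine_distributed N Z" "0 \<le> a" "a \<le> b" "b \<le> 1"
  shows "measure N {\<omega> \<in> space N. a < Z \<omega> \<and> Z \<omega> \<le> b} = arcsine_cdf b - arcsine_cdf a"
proof -
  have dist: "distributed N lborel Z arcsine_density"
    using assms by (simp add: arcsine_distributed_def)
  have "(arcsine_density has_integral (arcsine_cdf b - arcsine_cdf a)) {a..b}"
  proof (rule fundamental_theorem_of_calculus_interior[OF assms(3)])
    show "continuous_on {a..b} arcsine_cdf"
      by (rule continuous_on_subset[OF arcsine_cdf_continuous]) (use assms in auto)
    show "(arcsine_cdf has_vector_derivative arcsine_density x) (at x)" if "x \<in> {a<..<b}" for x
      using arcsine_cdf_deriv[of x] that assms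
      by (simp add: has_real_derivative_iff_has_vector_derivative)
  qed
  from nn_integral_has_integral_lebesgue[OF arcsine_density_nonneg this]
  have *: "(\<integral>\<^sup>+x. ennreal (indicator {a..b} x * arcsine_density x) \<partial>lborel)
      = ennreal (arcsine_cdf b - arcsine_cdf a)" .
  have "emeasure N (Z -` {a<..b} \<inter> space N)
      = (\<integral>\<^sup>+x. ennreal (arcsine_density x) * indicator {a<..b} x \<partial>lborel)"
    by (rule distributed_emeasure[OF dist]) simp
  also have "\<dots> = (\<integral>\<^sup>+x. ennreal (indicator {a..b} x * arcsine_density x) \<partial>lborel)"
    by (rule nn_integral_cong_AE, use AE_lborel_singleton[of a] in eventually_elim)
       (auto simp: indicator_def)
  also note *
  finally have "emeasure N (Z -` {a<..b} \<inter> space N) = ennreal (arcsine_cdf b - arcsine_cdf a)" .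
  moreover have "Z -` {a<..b} \<inter> space N = {\<omega> \<in> space N. a < Z \<omega> \<and> Z \<omega> \<le> b}" by auto
  ultimately show ?thesis
    using arcsine_cdf_mono[of a b] assms by (simp add: measure_def)
qed

text \<open>The variable that equals \<open>k / n\<close> when \<open>Z\<close> is in the \<open>k\<close>-th interval has the weights
  \<open>arcsine_pmf n\<close>, and on that interval \<open>Z\<close> is between \<open>(k - 2) / n\<close> and \<open>(k + 2) / n\<close>. So the expectations
  can be compared under a single measure, that of \<open>Z\<close>.\<close>
lemma arcsine_quantile_coupling:
  assumes Z: "arcsine_distributed N Z" and n: "n \<ge> 1" and h: "1-lipschitz_on UNIV h"
  shows "\<bar>(\<Sum>k\<le>n. arcsine_pmf n k * h (real k / real n)) - (\<integral>\<omega>. h (Z \<omega>) \<partial>N)\<bar> \<le> 2 / real n"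
proof -
  interpret prob_space N using Z by (simp add: arcsine_distributed_def)
  have Zm [measurable]: "Z \<in> borel_measurable N"
    using Z by (auto simp: arcsine_distributed_def dest: distributed_measurable)
  have lip: "\<bar>h x - h y\<bar> \<le> \<bar>x - y\<bar>" for x y
    using lipschitz_onD[OF h, of x y] by (simp add: dist_real_def)
  have [measurable]: "h \<in> borel_measurable borel"
    using lipschitz_on_continuous_on[OF h] by (rule borel_measurable_continuous_onI)
  define A where "A = (\<lambda>k. {\<omega> \<in> space N. arcsine_cut n k < Z \<omega> \<and> Z \<omega> \<le> arcsine_cut n (Suc k)})"
  have [measurable]: "A k \<in> sets N" for k unfolding A_def by measurable
  have cut0: "arcsine_cut n 0 = 0"
    by (simp add: arcsine_cut_def arcsine_sum_def arcsine_quantile_def)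
  have cut1: "arcsine_cut n (Suc n) = 1"
    by (simp add: arcsine_cut_def arcsine_sum_total arcsine_quantile_def)
  have cut_mono: "arcsine_cut n i \<le> arcsine_cut n j" if "i \<le> j" "j \<le> Suc n" for i j
    unfolding arcsine_cut_def
    using that arcsine_sum_bounds[of i n] arcsine_sum_bounds[of j n]
    by (intro arcsine_quantile_mono arcsine_sum_mono) auto
  have prob_A: "prob (A k) = arcsine_pmf n k" if "k \<le> n" for k
  proof -
    have "prob (A k) = arcsine_cdf (arcsine_cut n (Suc k)) - arcsine_cdf (arcsine_cut n k)"
      unfolding A_def
      by (rule arcsine_distributed_cdf[OF Z]) (use that cut_mono in \<open>auto simp: arcsine_cut_def arcsine_quantile_bounds\<close>)
    then show ?thesis
      using that arcsine_sum_bounds[of k n] arcsine_sum_bounds[of "Suc k" n]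
      by (simp add: arcsine_cut_def arcsine_cdf_quantile arcsine_sum_Suc)
  qed
  have range: "AE \<omega> in N. 0 < Z \<omega> \<and> Z \<omega> \<le> 1"
  proof -
    have "prob {\<omega> \<in> space N. 0 < Z \<omega> \<and> Z \<omega> \<le> 1} = 1"
      using arcsine_distributed_cdf[OF Z, of 0 1] by (simp add: arcsine_cdf_def)
    from AE_prob_1[OF this] show ?thesis by eventually_elim simp
  qed
  define S where "S = (\<lambda>\<omega>. \<Sum>k\<le>n. h (real k / real n) * indicator (A k) \<omega>)"
  have close: "AE \<omega> in N. \<bar>S \<omega> - h (Z \<omega>)\<bar> \<le> 2 / real n"
    using range AE_space
  proof eventually_elim
    case (elim \<omega>)
    \<comment> \<open>The interval that contains \<open>Z \<omega>\<close> ends at the first cut that is not below \<open>Z \<omega>\<close>.\<close>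
    define i where "i = (LEAST i. Z \<omega> \<le> arcsine_cut n i)"
    have i: "Z \<omega> \<le> arcsine_cut n i" and i_le: "i \<le> Suc n"
      using elim cut1 LeastI[of "\<lambda>i. Z \<omega> \<le> arcsine_cut n i" "Suc n"]
      unfolding i_def by (auto intro: Least_le)
    have "i \<noteq> 0"
    proof
      assume "i = 0"
      then show False using i elim cut0 by simp
    qed
    then obtain k where k: "i = Suc k" by (cases i) auto
    have "\<not> Z \<omega> \<le> arcsine_cut n k"
      using not_less_Least[of k "\<lambda>i. Z \<omega> \<le> arcsine_cut n i"] k unfolding i_def by simp
    then have Zk: "arcsine_cut n k < Z \<omega>" "Z \<omega> \<le> arcsine_cut n (Suc k)" "k \<le> n"
      using i i_le k by auto
    have "\<omega> \<in> A j \<longleftrightarrow> j = k" if "j \<le> n" for j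
    proof -
      consider "j < k" | "j = k" | "k < j" by linarith
      then show ?thesis
      proof cases
        case 1
        with cut_mono[of "Suc j" k] Zk show ?thesis by (auto simp: A_def)
      next
        case 3
        with cut_mono[of "Suc k" j] Zk that show ?thesis by (auto simp: A_def)
      qed (use Zk elim in \<open>auto simp: A_def\<close>)
    qed
    then have "S \<omega> = (\<Sum>j\<le>n. if j = k then h (real j / real n) else 0)"
      unfolding S_def by (intro sum.cong) (auto simp: indicator_def)
    also have "\<dots> = h (real k / real n)" using Zk by simp
    finally have "\<bar>S \<omega> - h (Z \<omega>)\<bar> \<le> \<bar>real k / real n - Z \<omega>\<bar>" using lip by simp
    also have "\<dots> \<le> 2 / real n"
      using Zk arcsine_cut_upper[OF n Zk(3)] arcsine_cut_lower[OF n Zk(3)]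
      by (auto simp: abs_le_iff add_divide_distrib diff_divide_distrib)
    finally show ?case .
  qed
  have int_S: "integrable N S"
    unfolding S_def by (intro Bochner_Integration.integrable_sum integrable_mult_right integrable_real_indicator)
      (auto simp: emeasure_eq_measure)
  have int_h: "integrable N (\<lambda>\<omega>. h (Z \<omega>))"
  proof (rule integrable_const_bound)
    show "AE \<omega> in N. norm (h (Z \<omega>)) \<le> \<bar>h 0\<bar> + 1"
      using range
    proof eventually_elim
      case (elim \<omega>)
      then have "\<bar>h (Z \<omega>) - h 0\<bar> \<le> 1" using lip[of "Z \<omega>" 0] by simp
      then show ?case by (simp add: abs_le_iff abs_if split: if_splits)
    qed
  qed measurable
  have "(\<Sum>k\<le>n. arcsine_pmf n k * h (real k / real n)) = (\<integral>\<omega>. S \<omega> \<partial>N)"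
    unfolding S_def by (subst Bochner_Integration.integral_sum)
      (auto simp: prob_A emeasure_eq_measure mult.commute intro!: integrable_mult_right integrable_real_indicator)
  then have "\<bar>(\<Sum>k\<le>n. arcsine_pmf n k * h (real k / real n)) - (\<integral>\<omega>. h (Z \<omega>) \<partial>N)\<bar>
      = \<bar>\<integral>\<omega>. S \<omega> - h (Z \<omega>) \<partial>N\<bar>"
    using int_S int_h by simp
  also have "\<dots> \<le> (\<integral>\<omega>. \<bar>S \<omega> - h (Z \<omega>)\<bar> \<partial>N)" by (rule integral_abs_bound)
  also have "\<dots> \<le> 2 / real n"
    by (rule integral_le_const) (use int_S int_h close in auto)
  finally show ?thesis .
qed

section \<open>The lower bound\<close>

text \<open>A smooth substitute for the distance to the nearest multiple of \<open>1 / n\<close>.\<close>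
definition lattice_test :: "nat \<Rightarrow> real \<Rightarrow> real" where
  "lattice_test n x = (sin (pi * real n * x))\<^sup>2 / (pi * real n)"

lemma lattice_test_lipschitz:
  assumes "n \<ge> 1"
  shows "1-lipschitz_on UNIV (lattice_test n)"
proof (rule lipschitz_onI)
  fix x y :: real
  have deriv: "(lattice_test n has_real_derivative sin (2 * (pi * real n * x))) (at x)" for x
    unfolding lattice_test_def[abs_def] using assms
    by (auto intro!: derivative_eq_intros simp: sin_double)
  have "norm (lattice_test n y - lattice_test n x) \<le> 1 * norm (y - x)" for x y
    by (rule field_differentiable_bound[of UNIV]) (auto intro: deriv DERIV_subset)
  then show "dist (lattice_test n x) (lattice_test n y) \<le> 1 * dist x y"
    by (simp add: dist_norm)
qed simp

lemma lattice_test_lattice: "lattice_test n (real k / real n) = 0"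
  by (cases "n = 0") (simp_all add: lattice_test_def)

lemma arcsine_density_ge: "0 < x \<Longrightarrow> x < 1 \<Longrightarrow> 2 / pi \<le> arcsine_density x"
  using arcsine_density_mono[of x "1 / 2"] sum_squares_ge_zero[of "x - 1 / 2" 0]
  by (simp add: arcsine_density_def[of "1/2"] real_sqrt_divide algebra_simps)

text \<open>Since the density is at least \<open>2 / \<pi>\<close> on the open unit interval, the expectation is at least \<open>2 / \<pi>\<close> times
  the integral of the test function over the unit interval, which is \<open>1 / (2 * \<pi> * n)\<close>. At the two end points, where
  the density is set to \<open>0\<close>, the test function vanishes.\<close>
lemma expectation_lattice_test:
  assumes Z: "arcsine_distributed N Z" and n: "n \<ge> 1"
  shows "1 / (pi\<^sup>2 * real n) \<le> (\<integral>\<omega>. lattice_test n (Z \<omega>) \<partial>N)"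
proof -
  interpret prob_space N using Z by (simp add: arcsine_distributed_def)
  have dist: "distributed N lborel Z arcsine_density"
    using Z by (simp add: arcsine_distributed_def)
  have Zm [measurable]: "Z \<in> borel_measurable N"
    using distributed_measurable[OF dist] by simp
  have [measurable]: "lattice_test n \<in> borel_measurable borel"
    unfolding lattice_test_def[abs_def] by measurable
  have nonneg: "0 \<le> lattice_test n x" for x by (simp add: lattice_test_def)
  define H where "H = (\<lambda>x. 2 / (pi\<^sup>2 * real n) * (x / 2 - sin (2 * (pi * real n * x)) / (4 * (pi * real n))))"
  have "has_bochner_integral lborel (\<lambda>x. 2 / pi * lattice_test n x * indicator {0..1} x) (H 1 - H 0)"
  proof (rule has_bochner_integral_FTC_Icc_real)
    fix x :: real
    have "(H has_real_derivative
        2 / (pi\<^sup>2 * real n) * (1 / 2 - cos (2 * (pi * real n * x)) / 2)) (at x)"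
      unfolding H_def using n by (auto intro!: derivative_eq_intros)
    also have "2 / (pi\<^sup>2 * real n) * (1 / 2 - cos (2 * (pi * real n * x)) / 2) = 2 / pi * lattice_test n x"
      unfolding lattice_test_def cos_double_sin by (simp add: diff_divide_distrib power2_eq_square)
    finally show "(H has_real_derivative 2 / pi * lattice_test n x) (at x)" .
    show "isCont (\<lambda>x. 2 / pi * lattice_test n x) x"
      unfolding lattice_test_def by (intro continuous_intros) (use n in auto)
  qed simp
  moreover have "H 1 - H 0 = 1 / (pi\<^sup>2 * real n)"
    using sin_npi[of "2 * n"] by (simp add: H_def mult_ac)
  ultimately have int: "integrable lborel (\<lambda>x. 2 / pi * lattice_test n x * indicator {0..1} x)"
    and eq: "(\<integral>x. 2 / pi * lattice_test n x * indicator {0..1} x \<partial>lborel) = 1 / (pi\<^sup>2 * real n)"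
    by (auto simp: has_bochner_integral_iff)
  have "integrable N (\<lambda>\<omega>. lattice_test n (Z \<omega>))"
    by (rule integrable_const_bound[of _ "1 / (pi * real n)"])
       (auto simp: lattice_test_def power2_eq_square[symmetric] abs_square_le_1 divide_right_mono)
  then have int': "integrable lborel (\<lambda>x. arcsine_density x * lattice_test n x)"
    using distributed_integrable[OF dist, of "lattice_test n"] by (simp add: arcsine_density_nonneg)
  have "2 / pi * lattice_test n x * indicator {0..1} x \<le> arcsine_density x * lattice_test n x" for x
  proof (cases "0 < x \<and> x < 1")
    case True
    then show ?thesis
      using mult_right_mono[OF arcsine_density_ge[of x] nonneg[of x]] by simp
  next
    case False
    then show ?thesis
      using lattice_test_lattice[of n 0] lattice_test_lattice[of n n] n
        arcsine_density_nonneg[of x] nonneg[of x]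
      by (cases "x = 0"; cases "x = 1") auto
  qed
  then have "(\<integral>x. 2 / pi * lattice_test n x * indicator {0..1} x \<partial>lborel)
      \<le> (\<integral>x. arcsine_density x * lattice_test n x \<partial>lborel)"
    by (intro integral_mono int int')
  also have "\<dots> = (\<integral>\<omega>. lattice_test n (Z \<omega>) \<partial>N)"
    by (rule distributed_integral[OF dist]) (auto simp: arcsine_density_nonneg)
  finally show ?thesis unfolding eq .
qed

section \<open>Bounds on the Wasserstein distance\<close>

lemma (in simple_random_walk) wasserstein_discrete_arcsine_le:
  assumes f: "discrete_arcsine (2 * n) f" "\<And>\<omega>. S \<omega> = f (steps (2 * n) \<omega>)"
    and Z: "arcsine_distributed N Z" and n: "n \<ge> 1"
  shows "wasserstein_dist M (\<lambda>\<omega>. real (S \<omega>) / (2 * real n)) N Z \<le> ereal (2 / real n)"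
  unfolding wasserstein_dist_def
proof (rule SUP_least)
  fix h :: "real \<Rightarrow> real" assume "h \<in> {h. 1-lipschitz_on UNIV h}"
  then have "1-lipschitz_on UNIV h" by simp
  from arcsine_quantile_coupling[OF Z n this]
  show "ereal \<bar>(\<integral>\<omega>. h (real (S \<omega>) / (2 * real n)) \<partial>M) - (\<integral>\<omega>. h (Z \<omega>) \<partial>N)\<bar> \<le> ereal (2 / real n)"
    unfolding expectation_discrete_arcsine[OF f] by simp
qed

lemma (in simple_random_walk) wasserstein_discrete_arcsine_ge:
  assumes f: "discrete_arcsine (2 * n) f" "\<And>\<omega>. S \<omega> = f (steps (2 * n) \<omega>)"
    and Z: "arcsine_distributed N Z" and n: "n \<ge> 1"
  shows "wasserstein_dist M (\<lambda>\<omega>. real (S \<omega>) / (2 * real n)) N Z \<ge> ereal (1 / pi\<^sup>2 / real n)"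
proof -
  have "(\<integral>\<omega>. lattice_test n (real (S \<omega>) / (2 * real n)) \<partial>M) = 0"
    unfolding expectation_discrete_arcsine[OF f] by (simp add: lattice_test_lattice)
  then have "1 / pi\<^sup>2 / real n \<le> \<bar>(\<integral>\<omega>. lattice_test n (real (S \<omega>) / (2 * real n)) \<partial>M)
      - (\<integral>\<omega>. lattice_test n (Z \<omega>) \<partial>N)\<bar>"
    using expectation_lattice_test[OF Z n] by simp
  then show ?thesis
    unfolding wasserstein_dist_def
    by (intro SUP_upper2[of "lattice_test n"]) (auto simp: lattice_test_lipschitz[OF n])
qed

theorem theorem1p2:
  shows
    "(\<forall>(M :: 'a measure) X (N :: 'b measure) Z (n :: nat).
        simple_random_walk M X \<and> arcsine_distributed N Z \<and> n \<ge> 1 \<longrightarrow>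
          wasserstein_dist M (\<lambda>\<omega>. real (last_zero X (2 * n) \<omega>) / (2 * real n)) N Z
            \<le> ereal (27 / (2 * real n) + 8 / (real n)^2) \<and>
          wasserstein_dist M (\<lambda>\<omega>. real (segments_above X (2 * n) \<omega>) / (2 * real n)) N Z
            \<le> ereal (27 / (2 * real n) + 8 / (real n)^2) \<and>
          wasserstein_dist M (\<lambda>\<omega>. real (first_visit_end X (2 * n) \<omega>) / (2 * real n)) N Z
            \<le> ereal (27 / (2 * real n) + 8 / (real n)^2)) \<and>
     (\<exists>c :: real. c > 0 \<and>
        (\<forall>(M :: 'a measure) X (N :: 'b measure) Z (n :: nat).
           simple_random_walk M X \<and> arcsine_distributed N Z \<and> n \<ge> 1 \<longrightarrow>
             wasserstein_dist M (\<lambda>\<omega>. real (last_zero X (2 * n) \<omega>) / (2 * real n)) N Z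
               \<ge> ereal (c / real n)))"
proof (intro conjI allI impI exI[of _ "1 / pi\<^sup>2"]; (elim conjE)?)
  fix M :: "'a measure" and X and N :: "'b measure" and Z and n :: nat
  assume "simple_random_walk M X" and Z: "arcsine_distributed N Z" and n: "n \<ge> 1"
  interpret simple_random_walk M X by fact
  have bound: "ereal (2 / real n) \<le> ereal (27 / (2 * real n) + 8 / (real n)^2)"
    using n by (simp add: field_simps)
  note upper = order_trans[OF wasserstein_discrete_arcsine_le[OF _ _ Z n] bound]
  show "wasserstein_dist M (\<lambda>\<omega>. real (last_zero X (2 * n) \<omega>) / (2 * real n)) N Z
      \<le> ereal (27 / (2 * real n) + 8 / (real n)^2)"
    by (rule upper[OF discrete_arcsine_last_zero last_zero_eq]) simp
  show "wasserstein_dist M (\<lambda>\<omega>. real (segments_above X (2 * n) \<omega>) / (2 * real n)) N Z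
      \<le> ereal (27 / (2 * real n) + 8 / (real n)^2)"
    by (rule upper[OF discrete_arcsine_above segments_above_eq]) simp
  show "wasserstein_dist M (\<lambda>\<omega>. real (first_visit_end X (2 * n) \<omega>) / (2 * real n)) N Z
      \<le> ereal (27 / (2 * real n) + 8 / (real n)^2)"
    by (rule upper[OF discrete_arcsine_first_visit first_visit_end_eq]) simp
  show "ereal (1 / pi\<^sup>2 / real n)
      \<le> wasserstein_dist M (\<lambda>\<omega>. real (last_zero X (2 * n) \<omega>) / (2 * real n)) N Z"
    by (rule wasserstein_discrete_arcsine_ge[OF discrete_arcsine_last_zero last_zero_eq Z n]) simp
qed simp

end
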